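(* Let $X$ be a ground set with $|X| = n$, let $d \ge 1$ and $1 \le d_1 \le d$ be constants, set $d_2 = d - d_1$, and let $C>0$ be a constant. Let $\mathcal{P} \subseteq 2^X$ be a set system with primal shatter dimension $d$ and size-sensitive shattering constants $d_1, d_2$ (with constant $C$). Let $\delta \in \{1, \dots, n\}$ and suppose $\mathcal{P}$ is $\delta$-separated. For an integer $l$, let $\mathcal{P}_l$ be the collection of sets of size $l$ in $\mathcal{P}$, and let $M = M(l) = |\mathcal{P}_l|$. Then $$ M \le c^* \left(\frac{n}{\delta}\right)^{d_1} \left(\frac{l}{\delta}\right)^{d_2}, $$ where $c^*$ is a constant independent of $n$, $l$, $\delta$.
   Context: For a set system $(X,\mathcal{S})$ and $Y \subseteq X$, the projection is $\mathcal{S}|_Y = \{S \cap Y : S \in \mathcal{S}\}$. The primal shatter function is $\pi_{\mathcal{S}}(m) = \max_{Y \subseteq X, |Y| = m} |\mathcal{S}|_Y|$; the system has primal shatter dimension $d$ if $\pi_{\mathcal{S}}(m) \le C m^d$ for all $m \le n$. It has size-sensitive shattering constants $d_1$ and $d_2 = d - d_1$ (where $1 \le d_1 \le d$) if for every $Y \subseteq X$ with $|Y| = m$, $1 \le m \le n$, and every $1 \le k \le m$, the number of sets of size at most $k$ in $\mathcal{S}|_Y$ is at most $C m^{d_1} k^{d-d_1}$. (Formally these dimensions are defined for a family of set systems with ground sets of every size and a common constant $C$; constants in bounds depend only on $d, d_1, C$.) A family $\mathcal{P}$ is $\delta$-separated if for all distinct $S_1, S_2 \in \mathcal{P}$, $|S_1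 \Delta S_2| > \delta$, where $S_1\Delta S_2$ is the symmetric difference.
   Formalization: Added hypothesis: if d_2 > 0 and M(l) = 1, then δ ≤ 2l. Without it the claim fails: for P = {{1}}, l = 1, δ = n, we have M = 1 but the bound is c*/n^{d_2}. The shatter bound is read for 1 ≤ m ≤ n. *)

theory Defs
  imports Complex_Main
begin

definition projection :: "'a set set \<Rightarrow> 'a set \<Rightarrow> 'a set set" where
  "projection P Y = {S \<inter> Y | S. S \<in> P}"

text \<open>Only meaningful for finite \<open>X\<close> and \<open>m \<le> card X\<close>, where the maximum is over a finite
  nonempty set.\<close>

definition primal_shatter :: "'a set \<Rightarrow> 'a set set \<Rightarrow> nat \<Rightarrow> nat" where
  "primal_shatter X P m = Max {card (projection P Y) | Y. Y \<subseteq> X \<and> card Y = m}"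

text \<open>The range starts at \<open>m = 1\<close>: for \<open>m = 0\<close> and nonempty \<open>P\<close> the left-hand side is 1 and the
  right-hand side is 0.\<close>

definition has_primal_shatter_dim :: "'a set \<Rightarrow> 'a set set \<Rightarrow> real \<Rightarrow> real \<Rightarrow> bool" where
  "has_primal_shatter_dim X P d C \<longleftrightarrow>
     (\<forall>m. 1 \<le> m \<and> m \<le> card X \<longrightarrow> real (primal_shatter X P m) \<le> C * real m powr d)"

definition has_size_sensitive_constants ::
    "'a set \<Rightarrow> 'a set set \<Rightarrow> real \<Rightarrow> real \<Rightarrow> real \<Rightarrow> bool" where
  "has_size_sensitive_constants X P d1 d2 C \<longleftrightarrow>
     (\<forall>Y m k. Y \<subseteq> X \<and> card Y = m \<and> 1 \<le> m \<and> m \<le> card X \<and> 1 \<le> k \<and> k \<le> m \<longrightarrow>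
        real (card {S \<in> projection P Y. card S \<le> k}) \<le> C * real m powr d1 * real k powr d2)"

definition separated :: "nat \<Rightarrow> 'a set set \<Rightarrow> bool" where
  "separated \<delta> P \<longleftrightarrow> (\<forall>S\<in>P. \<forall>T\<in>P. S \<noteq> T \<longrightarrow> card (sym_diff S T) > \<delta>)"

definition layer :: "'a set set \<Rightarrow> nat \<Rightarrow> 'a set set" where
  "layer P l = {S \<in> P. card S = l}"

text \<open>The library has \<open>0 powr 0 = 0\<close>; this variant follows the convention \<open>0\<^sup>0 = 1\<close>.\<close>

definition real_pow :: "real \<Rightarrow> real \<Rightarrow> real" where
  "real_pow x a = (if a = 0 then 1 else x powr a)"

lemma real_pow_eq_powr: "x \<noteq> 0 \<or> a \<noteq> 0 \<Longrightarrow> real_pow x a = x powr a"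
  by (auto simp: real_pow_def)

text \<open>A family with a single set is \<open>\<delta>\<close>-separated for every \<open>\<delta>\<close>. If \<open>d2 > 0\<close> and that set has size
  \<open>l\<close> much smaller than \<open>\<delta>\<close>, then \<open>(n / \<delta>)\<^bsup>d1\<^esup> (l / \<delta>)\<^bsup>d2\<^esup>\<close> can be arbitrarily small (for
  instance \<open>l = 1\<close> and \<open>\<delta> = n\<close>), so no constant makes it an upper bound for the number 1 of such
  sets. This predicate excludes that degenerate case; when at least two sets have size \<open>l\<close>,
  separation already gives \<open>\<delta> < 2 * l\<close>.\<close>

definition nondegenerate_layer :: "'a set set \<Rightarrow> real \<Rightarrow> nat \<Rightarrow> nat \<Rightarrow> bool" where
  "nondegenerate_layer P d2 \<delta> l \<longleftrightarrow> (d2 > 0 \<and> card (layer P l) = 1 \<longrightarrow> \<delta> \<le> 2 * l)"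

end

theory Submission
  imports Defs "HOL-Real_Asymp.Real_Asymp"
begin

text \<open>Haussler's packing argument, adapted to shallow layers. Let \<open>F\<close> be the layer, let \<open>D\<close> bound the size
  of shattered sets, and project \<open>F\<close> onto a uniformly random \<open>m\<close>-subset \<open>A\<close> of \<open>X\<close> with
  \<open>m \<approx> 8 D n / \<delta>\<close>. For \<open>A\<close> enlarged by one more random point \<open>a\<close>, weight each trace by the number of
  sets of \<open>F\<close> that induce it. The one-inclusion graph bounds the total weight of unit-distance pairs by
  \<open>D |F|\<close>, while separation forces \<open>a\<close> to split each trace class of size \<open>b\<close> with weight about
  \<open>(b - 1) \<delta> / (2 n)\<close>; hence on average \<open>F\<close> has at least \<open>(3/4) |F|\<close> distinct traces on \<open>A\<close>. By Markov's
  inequality at most a quarter of the sets of \<open>F\<close> meet \<open>A\<close> in more than \<open>k \<approx> 4 l m / n\<close> points, and the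
  size-sensitive bound counts the remaining traces. For \<open>\<delta> \<le> 9 D\<close> no such \<open>m \<le> n\<close> need exist, but then
  the size-sensitive bound for \<open>X\<close> itself is already strong enough.\<close>

section \<open>Edge weights in one-inclusion graphs\<close>

lemma sum_Pow_insert:
  fixes f :: "'a set \<Rightarrow> 'b::comm_monoid_add"
  assumes "finite A" "x \<notin> A"
  shows "(\<Sum>Q\<in>Pow (insert x A). f Q) = (\<Sum>Q\<in>Pow A. f Q + f (insert x Q))"
proof -
  have "inj_on (insert x) (Pow A)"
    using assms(2) by (intro inj_onI) (metis PowD insert_ident subsetD)
  moreover have "Pow A \<inter> insert x ` Pow A = {}" using assms(2) by auto
  ultimately show ?thesis
    using assms(1) by (simp add: Pow_insert sum.union_disjoint sum.reindex sum.distrib)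
qed

text \<open>Weighted form of the bound of edges by vertices in the one-inclusion graph of a class of
  bounded VC dimension; weights 0 and 1 give the unweighted case. An edge carries the smaller of its
  end weights, which later becomes the smaller side of the split of a trace class by one
  point.\<close>

lemma weighted_one_inclusion_bound:
  fixes w :: "'a set \<Rightarrow> nat"
  assumes "finite A"
    and "\<And>B. B \<subseteq> A \<Longrightarrow> (\<And>Z. Z \<subseteq> B \<Longrightarrow> \<exists>Q\<subseteq>A. w Q > 0 \<and> Q \<inter> B = Z) \<Longrightarrow> card B < D"
  shows "(\<Sum>a\<in>A. \<Sum>Q\<in>Pow (A - {a}). min (w Q) (w (insert a Q))) \<le> D * (\<Sum>Q\<in>Pow A. w Q)"
  using assms
proof (induction A arbitrary: w D rule: finite_induct)
  case empty
  then show ?case by simp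
next
  case (insert x A)
  \<comment> \<open>Merging \<open>Q\<close> with \<open>insert x Q\<close> into \<open>hi\<close> and \<open>lo\<close> preserves the total weight and does not decrease
    the edge weight; a set shattered by the support of \<open>lo\<close> stays shattered after adding \<open>x\<close>.\<close>
  define hi where "hi Q = max (w Q) (w (insert x Q))" for Q
  define lo where "lo Q = min (w Q) (w (insert x Q))" for Q
  let ?edges = "\<lambda>v. \<Sum>a\<in>A. \<Sum>Q\<in>Pow (A - {a}). min (v Q) (v (insert a Q))"
  have total: "(\<Sum>Q\<in>Pow (insert x A). w Q) = (\<Sum>Q\<in>Pow A. hi Q) + (\<Sum>Q\<in>Pow A. lo Q)"
    by (simp add: sum_Pow_insert[OF insert.hyps] hi_def lo_def flip: sum.distrib)
       (intro sum.cong; simp)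
  show ?case
  proof (cases "D = 0")
    case True
    \<comment> \<open>A single set of positive weight already shatters the empty set, so
      \<open>D = 0\<close> forces all weights to vanish.\<close>
    have "\<not> w Q > 0" if "Q \<subseteq> insert x A" for Q
    proof
      assume "w Q > 0"
      then have "card ({} :: 'a set) < D" using that by (intro insert.prems) auto
      then show False using True by simp
    qed
    then have "\<forall>Q\<in>Pow (insert x A). w Q = 0" by auto
    then have "\<forall>a\<in>insert x A. \<forall>Q\<in>Pow (insert x A - {a}). min (w Q) (w (insert a Q)) = 0"
      by (auto simp: min_def)
    then show ?thesis by (metis (no_types, lifting) le0 sum.neutral)
  next
    case False
    have hi: "?edges hi \<le> D * (\<Sum>Q\<in>Pow A. hi Q)"
    proof (rule insert.IH)
      fix B assume B: "B \<subseteq> A" and sh: "\<And>Z. Z \<subseteq> B \<Longrightarrow> \<exists>Q\<subseteq>A. hi Q > 0 \<and> Q \<inter> B = Z"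
      show "card B < D"
      proof (rule insert.prems)
        show "B \<subseteq> insert x A" using B by auto
        fix Z assume "Z \<subseteq> B"
        from sh[OF this] obtain Q where Q: "Q \<subseteq> A" "hi Q > 0" "Q \<inter> B = Z" by auto
        have "insert x Q \<inter> B = Z" using Q B insert.hyps by auto
        then show "\<exists>Q\<subseteq>insert x A. w Q > 0 \<and> Q \<inter> B = Z"
          using Q unfolding hi_def less_max_iff_disj
          by (metis insert_mono subset_insertI2)
      qed
    qed
    have lo: "?edges lo \<le> (D - 1) * (\<Sum>Q\<in>Pow A. lo Q)"
    proof (rule insert.IH)
      fix B assume B: "B \<subseteq> A" and sh: "\<And>Z. Z \<subseteq> B \<Longrightarrow> \<exists>Q\<subseteq>A. lo Q > 0 \<and> Q \<inter> B = Z"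
      have "card (insert x B) < D"
      proof (rule insert.prems)
        show "insert x B \<subseteq> insert x A" using B by auto
        fix Z assume Z: "Z \<subseteq> insert x B"
        have "Z - {x} \<subseteq> B" using Z by auto
        from sh[OF this] obtain Q where Q: "Q \<subseteq> A" "lo Q > 0" "Q \<inter> B = Z - {x}" by auto
        show "\<exists>Q\<subseteq>insert x A. w Q > 0 \<and> Q \<inter> insert x B = Z"
        proof (cases "x \<in> Z")
          case True
          then show ?thesis
            using Q by (intro exI[of _ "insert x Q"]) (auto simp: lo_def)
        next
          case False
          then show ?thesis
            using Q insert.hyps by (intro exI[of _ Q]) (auto simp: lo_def)
        qed
      qed
      moreover have "card (insert x B) = Suc (card B)"
        using B insert.hyps by (metis card_insert_disjoint finite_subset subsetD)
      ultimately show "card B < D - 1" by simp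
    qed
    have split: "(\<Sum>Q\<in>Pow (insert x A - {a}). min (w Q) (w (insert a Q)))
        \<le> (\<Sum>Q\<in>Pow (A - {a}). min (hi Q) (hi (insert a Q)))
          + (\<Sum>Q\<in>Pow (A - {a}). min (lo Q) (lo (insert a Q)))" if "a \<in> A" for a
    proof -
      have "insert x A - {a} = insert x (A - {a})" using that insert.hyps by auto
      then have "(\<Sum>Q\<in>Pow (insert x A - {a}). min (w Q) (w (insert a Q)))
        = (\<Sum>Q\<in>Pow (A - {a}). min (w Q) (w (insert a Q))
             + min (w (insert x Q)) (w (insert a (insert x Q))))"
        using insert.hyps by (simp add: sum_Pow_insert)
      \<comment> \<open>Of the two minima on the left, the smaller is the minimum of all four
        weights, which is the \<open>lo\<close> term, and the larger is at most the
        \<open>hi\<close> term.\<close>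
      also have "\<dots> \<le> (\<Sum>Q\<in>Pow (A - {a}). min (hi Q) (hi (insert a Q))
          + min (lo Q) (lo (insert a Q)))"
        by (intro sum_mono) (auto simp: hi_def lo_def insert_commute[of a x] min_def max_def)
      finally show ?thesis by (simp add: sum.distrib)
    qed
    \<comment> \<open>The edges in direction \<open>x\<close> weigh exactly the total of
      \<open>lo\<close>, which raises the factor \<open>D - 1\<close> for \<open>lo\<close> to
      \<open>D\<close>.\<close>
    have "(\<Sum>a\<in>insert x A. \<Sum>Q\<in>Pow (insert x A - {a}). min (w Q) (w (insert a Q)))
      = (\<Sum>Q\<in>Pow A. lo Q) + (\<Sum>a\<in>A. \<Sum>Q\<in>Pow (insert x A - {a}). min (w Q) (w (insert a Q)))"
      using insert.hyps by (simp add: lo_def)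
    also have "\<dots> \<le> (\<Sum>Q\<in>Pow A. lo Q) + (?edges hi + ?edges lo)"
      using sum_mono[of A, OF split] by (simp add: sum.distrib)
    also have "\<dots> \<le> (\<Sum>Q\<in>Pow A. lo Q) + (D * (\<Sum>Q\<in>Pow A. hi Q) + (D - 1) * (\<Sum>Q\<in>Pow A. lo Q))"
      using hi lo by simp
    also have "\<dots> = D * (\<Sum>Q\<in>Pow (insert x A). w Q)"
      using False unfolding total by (cases D) (simp_all add: algebra_simps)
    finally show ?thesis .
  qed
qed

section \<open>Double counting the traces of a separated family\<close>

text \<open>A point separates as many unordered pairs as the product of the two sides of its split.
  The sides add up to \<open>card G\<close>, so the product is at most \<open>card G\<close> times
  the smaller side, and the factor \<open>card G\<close> cancels.\<close>

lemma split_sum_lower_bound: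
  assumes "finite G" "finite Y"
    and sep: "\<And>S T. S \<in> G \<Longrightarrow> T \<in> G \<Longrightarrow> S \<noteq> T \<Longrightarrow> \<delta> \<le> card (sym_diff S T \<inter> Y)"
  shows "\<delta> * (card G - 1) \<le> 2 * (\<Sum>a\<in>Y. min (card {S\<in>G. a \<notin> S}) (card {S\<in>G. a \<in> S}))"
proof (cases "G = {}")
  case True
  then show ?thesis by simp
next
  case False
  let ?out = "\<lambda>a. {S\<in>G. a \<notin> S}" and ?in = "\<lambda>a. {S\<in>G. a \<in> S}"
  have cardG: "card (?out a) + card (?in a) = card G" for a
  proof -
    have "?out a \<union> ?in a = G" "?out a \<inter> ?in a = {}" by auto
    then show ?thesis using assms(1) by (metis (no_types, lifting) card_Un_disjoint finite_Un)
  qed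
  have pairs: "(\<Sum>S\<in>G. \<Sum>T\<in>G. if a \<in> sym_diff S T then 1 else 0)
      = 2 * (card (?out a) * card (?in a))" for a
  proof -
    have "(\<Sum>S\<in>G. \<Sum>T\<in>G. if a \<in> sym_diff S T then 1 else 0)
      = (\<Sum>S\<in>G. if a \<in> S then card (?out a) else card (?in a))"
      using assms(1) by (intro sum.cong) (auto simp: sum.If_cases Int_def)
    also have "\<dots> = 2 * (card (?out a) * card (?in a))"
      using assms(1) by (simp add: sum.If_cases Int_def)
    finally show ?thesis .
  qed
  \<comment> \<open>Count triples \<open>(S, T, a)\<close> with \<open>a \<in> sym_diff S T \<inter> Y\<close> in two ways.\<close>
  have "card G * (\<delta> * (card G - 1)) = (\<Sum>S\<in>G. \<Sum>T\<in>G - {S}. \<delta>)"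
    using assms(1) by simp
  also have "\<dots> \<le> (\<Sum>S\<in>G. \<Sum>T\<in>G - {S}. card (sym_diff S T \<inter> Y))"
    by (intro sum_mono sep) auto
  also have "\<dots> \<le> (\<Sum>S\<in>G. \<Sum>T\<in>G. card (sym_diff S T \<inter> Y))"
    using assms(1) by (intro sum_mono sum_mono2) auto
  also have "\<dots> = (\<Sum>S\<in>G. \<Sum>T\<in>G. \<Sum>a\<in>Y. if a \<in> sym_diff S T then 1 else 0)"
    using assms(2) by (intro sum.cong refl) (simp add: sum.If_cases Int_commute Int_def)
  also have "\<dots> = (\<Sum>S\<in>G. \<Sum>a\<in>Y. \<Sum>T\<in>G. if a \<in> sym_diff S T then 1 else 0)"
    by (intro sum.cong refl sum.swap)
  also have "\<dots> = (\<Sum>a\<in>Y. \<Sum>S\<in>G. \<Sum>T\<in>G. if a \<in> sym_diff S T then 1 else 0)"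
    by (rule sum.swap)
  also have "\<dots> = (\<Sum>a\<in>Y. 2 * (card (?out a) * card (?in a)))"
    by (simp only: pairs)
  also have "\<dots> \<le> (\<Sum>a\<in>Y. 2 * (card G * min (card (?out a)) (card (?in a))))"
  proof (intro sum_mono mult_le_mono2)
    fix a
    show "card (?out a) * card (?in a) \<le> card G * min (card (?out a)) (card (?in a))"
      using cardG[of a] by (auto simp: min_def mult.commute intro: mult_le_mono)
  qed
  also have "\<dots> = card G * (2 * (\<Sum>a\<in>Y. min (card (?out a)) (card (?in a))))"
    by (simp add: sum_distrib_left mult_ac)
  finally show ?thesis
    using False assms(1) by (simp add: card_gt_0_iff)
qed

text \<open>Deleting the marked point is a bijection from \<open>Suc m\<close>-sets with a marked
  element to \<open>m\<close>-sets with a marked point outside.\<close>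

lemma sum_subset_point_swap:
  fixes f :: "'a set \<Rightarrow> 'a \<Rightarrow> nat"
  assumes "finite X"
  shows "(\<Sum>A\<in>{A. A \<subseteq> X \<and> card A = Suc m}. \<Sum>a\<in>A. f A a)
    = (\<Sum>A\<in>{A. A \<subseteq> X \<and> card A = m}. \<Sum>a\<in>X - A. f (insert a A) a)"
proof -
  have fin: "finite A" if "A \<subseteq> X" for A using that assms finite_subset by auto
  have "(\<Sum>A\<in>{A. A \<subseteq> X \<and> card A = Suc m}. \<Sum>a\<in>A. f A a)
    = (\<Sum>(A, a)\<in>(SIGMA A:{A. A \<subseteq> X \<and> card A = Suc m}. A). f A a)"
    using assms fin by (subst sum.Sigma) auto
  also have "\<dots> = (\<Sum>(A, a)\<in>(SIGMA A:{A. A \<subseteq> X \<and> card A = m}. X - A). f (insert a A) a)"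
    by (rule sum.reindex_bij_witness[where i = "\<lambda>(A, a). (insert a A, a)"
          and j = "\<lambda>(A, a). (A - {a}, a)"]) (auto simp: fin insert_absorb)
  also have "\<dots> = (\<Sum>A\<in>{A. A \<subseteq> X \<and> card A = m}. \<Sum>a\<in>X - A. f (insert a A) a)"
    using assms by (subst sum.Sigma) auto
  finally show ?thesis .
qed

lemma projection_eq_image: "projection P Y = (\<lambda>S. S \<inter> Y) ` P"
  by (auto simp: projection_def)

lemma sum_fibres_projection:
  assumes "finite F" "finite A"
  shows "(\<Sum>Q\<in>Pow A. card {S\<in>F. S \<inter> A = Q}) = card F"
proof -
  have "card F = (\<Sum>S\<in>F. 1)" by simp
  also have "\<dots> = (\<Sum>Q\<in>Pow A. sum (\<lambda>_. 1) {S\<in>F. S \<inter> A = Q})"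
    using assms by (intro sum.group[symmetric]) auto
  finally show ?thesis by simp
qed

text \<open>Both sides are compared with one quantity, the edge weight summed over all
  \<open>Suc m\<close>-sets and all directions in them. The difference
  \<open>card F - card (projection F A)\<close> counts the sets of \<open>F\<close> in excess of one
  per trace.\<close>

lemma packing_double_count:
  assumes X: "finite X" and F: "F \<subseteq> Pow X" and sep: "separated \<delta> F"
    and vc: "\<And>B. B \<subseteq> X \<Longrightarrow> projection F B = Pow B \<Longrightarrow> card B < D"
  shows "\<delta> * (\<Sum>A\<in>{A. A \<subseteq> X \<and> card A = m}. card F - card (projection F A))
    \<le> 2 * (D * card F * (card X choose Suc m))"
proof -
  have finF: "finite F" using X F by (meson finite_Pow_iff finite_subset)
  define w where "w A Q = card {S\<in>F. S \<inter> A = Q}" for A Q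
  define edges where "edges A a = (\<Sum>Q\<in>Pow (A - {a}). min (w A Q) (w A (insert a Q)))" for A a
  have upper: "(\<Sum>a\<in>A. edges A a) \<le> D * card F" if A: "A \<subseteq> X" for A
  proof -
    have finA: "finite A" using A X finite_subset by auto
    have "(\<Sum>a\<in>A. edges A a) \<le> D * (\<Sum>Q\<in>Pow A. w A Q)"
      unfolding edges_def
    proof (rule weighted_one_inclusion_bound[OF finA])
      fix B assume B: "B \<subseteq> A" and sh: "\<And>Z. Z \<subseteq> B \<Longrightarrow> \<exists>Q\<subseteq>A. w A Q > 0 \<and> Q \<inter> B = Z"
      have "Z \<in> projection F B" if "Z \<subseteq> B" for Z
      proof -
        obtain Q where Q: "Q \<subseteq> A" "w A Q > 0" "Q \<inter> B = Z" using sh \<open>Z \<subseteq> B\<close> by blast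
        then have "{S\<in>F. S \<inter> A = Q} \<noteq> {}" unfolding w_def by (metis card.empty less_irrefl)
        then obtain S where "S \<in> F" "S \<inter> A = Q" by blast
        moreover from this have "S \<inter> B = Z" using Q B by blast
        ultimately show ?thesis by (auto simp: projection_def)
      qed
      then have "projection F B = Pow B" by (auto simp: projection_def)
      then show "card B < D" using vc A B by auto
    qed
    then show ?thesis unfolding w_def using sum_fibres_projection[OF finF finA] by simp
  qed
  have lower: "\<delta> * (card F - card (projection F A)) \<le> 2 * (\<Sum>a\<in>X - A. edges (insert a A) a)"
    if A: "A \<subseteq> X" for A
  proof -
    have finA: "finite A" using A X finite_subset by auto
    let ?G = "\<lambda>Q. {S\<in>F. S \<inter> A = Q}"
    have proj: "projection F A \<subseteq> Pow A" by (auto simp: projection_def)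
    have "card F = (\<Sum>Q\<in>projection F A. card (?G Q))"
    proof -
      have "card (?G Q) = 0" if "Q \<in> Pow A - projection F A" for Q
      proof -
        have "?G Q = {}" using that by (auto simp: projection_def)
        then show ?thesis by (simp only: card.empty)
      qed
      then have "(\<Sum>Q\<in>projection F A. card (?G Q)) = (\<Sum>Q\<in>Pow A. card (?G Q))"
        using finA by (intro sum.mono_neutral_left proj) auto
      then show ?thesis using sum_fibres_projection[OF finF finA] by simp
    qed
    also have "\<dots> = (\<Sum>Q\<in>projection F A. (card (?G Q) - 1) + 1)"
    proof (intro sum.cong refl)
      fix Q assume "Q \<in> projection F A"
      then have "?G Q \<noteq> {}" by (auto simp: projection_def)
      then show "card (?G Q) = (card (?G Q) - 1) + 1" using finF by (simp add: card_gt_0_iff Suc_leI)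
    qed
    also have "\<dots> = (\<Sum>Q\<in>projection F A. card (?G Q) - 1) + card (projection F A)"
      by (simp only: sum.distrib card_eq_sum)
    finally have "card F - card (projection F A) = (\<Sum>Q\<in>projection F A. card (?G Q) - 1)" by simp
    \<comment> \<open>\<open>Pow A\<close> is the range of summation in
      \<open>edges (insert a A) a\<close> for \<open>a\<close> outside \<open>A\<close>; empty
      classes contribute \<open>0 - 1 = 0\<close>.\<close>
    also have "\<dots> \<le> (\<Sum>Q\<in>Pow A. card (?G Q) - 1)"
      using proj finA by (intro sum_mono2) auto
    finally have "\<delta> * (card F - card (projection F A)) \<le> (\<Sum>Q\<in>Pow A. \<delta> * (card (?G Q) - 1))"
      by (simp flip: sum_distrib_left)
    also have "\<dots> \<le> (\<Sum>Q\<in>Pow A. 2 * (\<Sum>a\<in>X - A. min (w (insert a A) Q) (w (insert a A) (insert a Q))))"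
    proof (intro sum_mono)
      fix Q assume Q: "Q \<in> Pow A"
      have "\<delta> * (card (?G Q) - 1)
        \<le> 2 * (\<Sum>a\<in>X - A. min (card {S \<in> ?G Q. a \<notin> S}) (card {S \<in> ?G Q. a \<in> S}))"
      proof (rule split_sum_lower_bound)
        fix S T assume ST: "S \<in> ?G Q" "T \<in> ?G Q" "S \<noteq> T"
        \<comment> \<open>Sets with the same trace on \<open>A\<close> differ only outside
          \<open>A\<close>, so separation applies in full to \<open>X - A\<close>.\<close>
        then have "sym_diff S T \<inter> (X - A) = sym_diff S T" using F by blast
        then show "\<delta> \<le> card (sym_diff S T \<inter> (X - A))"
          using ST sep by (simp add: separated_def less_imp_le)
      qed (use finF X in auto)
      also have "\<dots> = 2 * (\<Sum>a\<in>X - A. min (w (insert a A) Q) (w (insert a A) (insert a Q)))"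
      proof -
        have "{S \<in> ?G Q. a \<notin> S} = {S \<in> F. S \<inter> insert a A = Q}"
          "{S \<in> ?G Q. a \<in> S} = {S \<in> F. S \<inter> insert a A = insert a Q}" if "a \<in> X - A" for a
          using that Q by auto
        then show ?thesis by (simp add: w_def)
      qed
      finally show "\<delta> * (card (?G Q) - 1)
        \<le> 2 * (\<Sum>a\<in>X - A. min (w (insert a A) Q) (w (insert a A) (insert a Q)))" .
    qed
    also have "\<dots> = 2 * (\<Sum>a\<in>X - A. \<Sum>Q\<in>Pow A. min (w (insert a A) Q) (w (insert a A) (insert a Q)))"
      by (simp add: sum.swap[of _ "X - A"] flip: sum_distrib_left)
    also have "\<dots> = 2 * (\<Sum>a\<in>X - A. edges (insert a A) a)"
      by (simp add: edges_def)
    finally show ?thesis .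
  qed
  have "\<delta> * (\<Sum>A\<in>{A. A \<subseteq> X \<and> card A = m}. card F - card (projection F A))
    \<le> (\<Sum>A\<in>{A. A \<subseteq> X \<and> card A = m}. 2 * (\<Sum>a\<in>X - A. edges (insert a A) a))"
    unfolding sum_distrib_left[of \<delta>] by (intro sum_mono lower) auto
  also have "\<dots> = 2 * (\<Sum>A\<in>{A. A \<subseteq> X \<and> card A = Suc m}. \<Sum>a\<in>A. edges A a)"
    unfolding sum_subset_point_swap[OF X] by (simp add: sum_distrib_left)
  also have "\<dots> \<le> 2 * (\<Sum>A\<in>{A. A \<subseteq> X \<and> card A = Suc m}. D * card F)"
    by (intro mult_le_mono2 sum_mono upper) auto
  finally show ?thesis by (simp add: n_subsets[OF X] mult_ac)
qed

section \<open>Averaging over random subsets\<close>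

text \<open>The mean of the hypergeometric distribution, with denominators cleared: for
  \<open>m > 0\<close>, each point of \<open>S\<close> lies in
  \<open>(card X - 1) choose (m - 1)\<close> of the sets \<open>A\<close>.\<close>

lemma sum_card_Int_subsets:
  assumes X: "finite X" and S: "S \<subseteq> X"
  shows "card X * (\<Sum>A\<in>{A. A \<subseteq> X \<and> card A = m}. card (S \<inter> A)) = card S * m * (card X choose m)"
proof (cases m)
  case 0
  have "{A. A \<subseteq> X \<and> card A = 0} = {{}}"
    using X by (auto simp: card_eq_0_iff dest: finite_subset)
  then show ?thesis using 0 by simp
next
  case (Suc m')
  have fin: "finite A" if "A \<subseteq> X" for A using that assms finite_subset by auto
  have "(\<Sum>A\<in>{A. A \<subseteq> X \<and> card A = m}. card (S \<inter> A))
    = (\<Sum>A\<in>{A. A \<subseteq> X \<and> card A = Suc m'}. \<Sum>a\<in>A. if a \<in> S then 1 else 0)"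
    unfolding Suc by (intro sum.cong refl) (simp add: sum.If_cases fin Int_def conj_commute)
  also have "\<dots> = (\<Sum>A\<in>{A. A \<subseteq> X \<and> card A = m'}. \<Sum>a\<in>X - A. if a \<in> S then 1 else 0)"
    by (rule sum_subset_point_swap[OF X])
  also have "\<dots> = (\<Sum>A\<in>{A. A \<subseteq> X \<and> card A = m'}. \<Sum>a\<in>X. if a \<in> S \<and> a \<notin> A then 1 else 0)"
    using X by (intro sum.cong refl sum.mono_neutral_cong_left) auto
  also have "\<dots> = (\<Sum>a\<in>X. \<Sum>A\<in>{A. A \<subseteq> X \<and> card A = m'}. if a \<in> S \<and> a \<notin> A then 1 else 0)"
    by (rule sum.swap)
  also have "\<dots> = (\<Sum>a\<in>S. \<Sum>A\<in>{A. A \<subseteq> X \<and> card A = m'}. if a \<notin> A then 1 else 0)"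
    using X S by (intro sum.mono_neutral_cong_right) auto
  also have "\<dots> = (\<Sum>a\<in>S. (card X - 1) choose m')"
  proof (intro sum.cong refl)
    fix a assume "a \<in> S"
    then have a: "a \<in> X" using S by auto
    have "(\<Sum>A\<in>{A. A \<subseteq> X \<and> card A = m'}. if a \<notin> A then 1 else 0)
      = card {A. A \<subseteq> X - {a} \<and> card A = m'}"
      using X by (simp add: sum.If_cases) (intro arg_cong[of _ _ card], auto)
    then show "(\<Sum>A\<in>{A. A \<subseteq> X \<and> card A = m'}. if a \<notin> A then 1 else 0) = (card X - 1) choose m'"
      using X a by (simp add: n_subsets)
  qed
  finally have eq: "(\<Sum>A\<in>{A. A \<subseteq> X \<and> card A = m}. card (S \<inter> A)) = card S * ((card X - 1) choose m')"
    by simp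
  show ?thesis
  proof (cases "card X")
    case 0
    then show ?thesis using Suc by simp
  next
    case (Suc n')
    have "card X * ((card X - 1) choose m') = m * (card X choose m)"
      using Suc_times_binomial_eq[of n' m'] unfolding Suc \<open>m = Suc m'\<close> diff_Suc_1
      by (simp only: mult.commute)
    then show ?thesis unfolding eq by (metis mult.assoc mult.left_commute)
  qed
qed


text \<open>The hypothesis \<open>m\<close> limits the average loss from coinciding traces to a
  quarter of \<open>card F\<close>, and \<open>k\<close> does the same for sets with large traces.
  The other half must be covered by the at most \<open>N\<close> small traces, whence the factor
  2.\<close>

lemma shallow_packing_bound:
  fixes N :: real
  assumes X: "finite X" "X \<noteq> {}" and F: "F \<subseteq> Pow X" and sep: "separated \<delta> F" and "\<delta> > 0"
    and size: "\<And>S. S \<in> F \<Longrightarrow> card S = l"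
    and vc: "\<And>B. B \<subseteq> X \<Longrightarrow> projection F B = Pow B \<Longrightarrow> card B < D"
    and m: "m \<le> card X" "8 * D * card X \<le> \<delta> * Suc m"
    and k: "4 * l * m \<le> card X * Suc k"
    and N: "\<And>A. A \<subseteq> X \<Longrightarrow> card A = m \<Longrightarrow> real (card {Q \<in> projection F A. card Q \<le> k}) \<le> N"
  shows "real (card F) \<le> 2 * N"
proof -
  define T where "T = {A. A \<subseteq> X \<and> card A = m}"
  define b where "b = card X choose m"
  define M where "M = card F"
  define large where "large A = {S\<in>F. k < card (S \<inter> A)}" for A
  have finF: "finite F" using X F by (meson finite_Pow_iff finite_subset)
  have finT: "finite T" using X by (simp add: T_def)
  have cardT: "card T = b" using X by (simp add: T_def b_def n_subsets)
  have n: "card X > 0" using X by (simp add: card_gt_0_iff)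
  have b: "b > 0" using m by (simp add: b_def)
  have missing: "4 * (\<Sum>A\<in>T. M - card (projection F A)) \<le> M * b"
  proof -
    let ?s = "\<Sum>A\<in>T. M - card (projection F A)"
    have "\<delta> * ?s \<le> 2 * (D * M * (card X choose Suc m))"
      unfolding T_def M_def by (rule packing_double_count[OF X(1) F sep vc])
    then have "\<delta> * ?s * Suc m \<le> 2 * (D * M * (card X choose Suc m)) * Suc m" by (rule mult_le_mono1)
    also have "\<dots> = 2 * D * M * (Suc m * (card X choose Suc m))" by (simp only: mult_ac)
    \<comment> \<open>Absorption returns from the number of \<open>Suc m\<close>-sets to the number
      \<open>b\<close> of \<open>m\<close>-sets, over which the average is taken.\<close>
    also have "Suc m * (card X choose Suc m) = (card X - m) * b"
      unfolding b_def using binomial_absorb_comp binomial_absorption m by metis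
    also have "2 * D * M * ((card X - m) * b) \<le> 2 * D * M * (card X * b)" by simp
    finally have "4 * (\<delta> * ?s * Suc m) \<le> 4 * (2 * D * M * (card X * b))" by (rule mult_le_mono2)
    also have "\<dots> = (8 * D * card X) * (M * b)" by simp
    also have "\<dots> \<le> (\<delta> * Suc m) * (M * b)" using m by (intro mult_le_mono1)
    finally have "(\<delta> * Suc m) * (4 * ?s) \<le> (\<delta> * Suc m) * (M * b)" by (simp only: mult_ac)
    then show ?thesis using \<open>\<delta> > 0\<close> by (subst (asm) mult_le_cancel1) simp
  qed
  have tail: "4 * (\<Sum>A\<in>T. card (large A)) \<le> M * b"
  proof -
    \<comment> \<open>Markov's inequality; for integers, more than \<open>k\<close> points means at
      least \<open>Suc k\<close>.\<close>
    have "Suc k * card (large A) \<le> (\<Sum>S\<in>F. card (S \<inter> A))" for A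
    proof -
      have "Suc k * card (large A) = (\<Sum>S\<in>large A. Suc k)" by simp
      also have "\<dots> \<le> (\<Sum>S\<in>large A. card (S \<inter> A))"
        by (intro sum_mono) (auto simp: large_def)
      also have "\<dots> \<le> (\<Sum>S\<in>F. card (S \<inter> A))"
        using finF by (intro sum_mono2) (auto simp: large_def)
      finally show ?thesis .
    qed
    then have "Suc k * (\<Sum>A\<in>T. card (large A)) \<le> (\<Sum>A\<in>T. \<Sum>S\<in>F. card (S \<inter> A))"
      unfolding sum_distrib_left by (intro sum_mono)
    also have "\<dots> = (\<Sum>S\<in>F. \<Sum>A\<in>T. card (S \<inter> A))" by (rule sum.swap)
    finally have "card X * (Suc k * (\<Sum>A\<in>T. card (large A)))
        \<le> card X * (\<Sum>S\<in>F. \<Sum>A\<in>T. card (S \<inter> A))" by (rule mult_le_mono2)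
    also have "\<dots> = (\<Sum>S\<in>F. l * m * b)"
      unfolding sum_distrib_left T_def b_def
    proof (intro sum.cong refl)
      fix S assume "S \<in> F"
      then show "(\<Sum>A | A \<subseteq> X \<and> card A = m. card X * card (S \<inter> A)) = l * m * (card X choose m)"
        using sum_card_Int_subsets[OF X(1), of S m] F size by (auto simp: sum_distrib_left)
    qed
    finally have "4 * (card X * (Suc k * (\<Sum>A\<in>T. card (large A)))) \<le> 4 * (\<Sum>S\<in>F. l * m * b)"
      by (rule mult_le_mono2)
    also have "\<dots> = (4 * l * m) * (M * b)" by (simp add: M_def)
    also have "\<dots> \<le> (card X * Suc k) * (M * b)" using k by (intro mult_le_mono1)
    finally have "(card X * Suc k) * (4 * (\<Sum>A\<in>T. card (large A))) \<le> (card X * Suc k) * (M * b)"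
      by (simp only: mult_ac)
    then show ?thesis using n by (subst (asm) mult_le_cancel1) simp
  qed
  have each: "real M \<le> real (M - card (projection F A)) + N + real (card (large A))"
    if "A \<in> T" for A
  proof -
    have "projection F A \<subseteq> {Q \<in> projection F A. card Q \<le> k} \<union> (\<lambda>S. S \<inter> A) ` large A"
    proof
      fix Q assume "Q \<in> projection F A"
      then obtain S where "S \<in> F" "Q = S \<inter> A" by (auto simp: projection_def)
      then show "Q \<in> {Q \<in> projection F A. card Q \<le> k} \<union> (\<lambda>S. S \<inter> A) ` large A"
        by (cases "card Q \<le> k") (auto simp: projection_eq_image large_def)
    qed
    then have "card (projection F A)
      \<le> card ({Q \<in> projection F A. card Q \<le> k} \<union> (\<lambda>S. S \<inter> A) ` large A)"
      using finF by (intro card_mono) (auto simp: projection_eq_image large_def)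
    also have "\<dots> \<le> card {Q \<in> projection F A. card Q \<le> k} + card ((\<lambda>S. S \<inter> A) ` large A)"
      by (rule card_Un_le)
    finally have "card (projection F A)
      \<le> card {Q \<in> projection F A. card Q \<le> k} + card ((\<lambda>S. S \<inter> A) ` large A)" .
    moreover have "card ((\<lambda>S. S \<inter> A) ` large A) \<le> card (large A)"
      using finF by (intro card_image_le) (simp add: large_def)
    moreover have "real (card {Q \<in> projection F A. card Q \<le> k}) \<le> N"
      using N that by (simp add: T_def)
    ultimately show ?thesis by linarith
  qed
  have "real M * real b = (\<Sum>A\<in>T. real M)" by (simp add: cardT)
  also have "\<dots> \<le> (\<Sum>A\<in>T. real (M - card (projection F A)) + N + real (card (large A)))"
    by (intro sum_mono each)
  also have "\<dots> = real (\<Sum>A\<in>T. M - card (projection F A)) + N * real b + real (\<Sum>A\<in>T. card (large A))"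
    by (simp add: sum.distrib cardT)
  finally have "real M * real b \<le> \<dots>" .
  moreover have "4 * real (\<Sum>A\<in>T. M - card (projection F A)) \<le> real M * real b"
    "4 * real (\<Sum>A\<in>T. card (large A)) \<le> real M * real b"
    using of_nat_mono[OF missing, where 'a = real] of_nat_mono[OF tail, where 'a = real]
    by simp_all
  ultimately have "real M * real b \<le> (2 * N) * real b" by linarith
  then show ?thesis using b by (simp add: M_def)
qed

section \<open>Consequences of the shattering and separation hypotheses\<close>

text \<open>Exponential beats polynomial growth. The threshold depends only on \<open>C\<close> and
  \<open>d\<close>, which keeps the final constant uniform in the set system.\<close>

lemma shatter_function_below_power2:
  "\<exists>D\<ge>1. \<forall>b\<ge>D. C * real b powr d < 2 ^ b"
proof -
  have "eventually (\<lambda>b::nat. C * real b powr d < 2 ^ b) at_top"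
    by real_asymp
  then obtain D where "\<forall>b\<ge>D. C * real b powr d < 2 ^ b"
    by (auto simp: eventually_at_top_linorder)
  then show ?thesis by (intro exI[of _ "max 1 D"]) auto
qed

text \<open>A shattered set of \<open>b\<close> points has \<open>2 ^ b\<close> traces, more than
  the shatter function allows once \<open>b \<ge> D\<close>. \<open>D \<ge> 1\<close> keeps
  \<open>b\<close> in the range of the dimension hypothesis, which starts at 1.\<close>

lemma shattered_card_less:
  assumes X: "finite X" and P: "P \<subseteq> Pow X" and dim: "has_primal_shatter_dim X P d C"
    and D: "D \<ge> 1" "\<And>b. b \<ge> D \<Longrightarrow> C * real b powr d < 2 ^ b"
    and B: "B \<subseteq> X" "projection P B = Pow B"
  shows "card B < D"
proof (rule ccontr)
  assume "\<not> card B < D"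
  then have big: "D \<le> card B" by simp
  have finB: "finite B" using B X by (auto dest: finite_subset)
  have "finite {card (projection P Y) | Y. Y \<subseteq> X \<and> card Y = card B}"
    using X by simp
  then have "card (projection P B) \<le> primal_shatter X P (card B)"
    unfolding primal_shatter_def using B(1) by (intro Max_ge) auto
  then have "2 ^ card B \<le> real (primal_shatter X P (card B))"
    unfolding B(2) card_Pow[OF finB] using of_nat_mono by fastforce
  also have "\<dots> \<le> C * real (card B) powr d"
    using dim big D(1) B X by (auto simp: has_primal_shatter_dim_def card_mono)
  finally show False using D(2)[OF big] by simp
qed

text \<open>The size-sensitive hypothesis requires \<open>k \<le> m\<close>. Traces on
  \<open>A\<close> have at most \<open>m\<close> points, so a larger \<open>k\<close> can be
  replaced by \<open>min k m\<close>, and monotonicity in \<open>k\<close> restores the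
  bound.\<close>

lemma size_sensitive_projection_bound:
  assumes X: "finite X" and P: "P \<subseteq> Pow X" and ss: "has_size_sensitive_constants X P d1 d2 C"
    and "C > 0" "d2 \<ge> 0" "F \<subseteq> P" "A \<subseteq> X" "card A = m" "1 \<le> m" "1 \<le> k"
  shows "real (card {Q \<in> projection F A. card Q \<le> k}) \<le> C * real m powr d1 * real k powr d2"
proof -
  have finA: "finite A" using X \<open>A \<subseteq> X\<close> finite_subset by auto
  have finP: "finite P" using X P by (meson finite_Pow_iff finite_subset)
  have "card Q \<le> m" if "Q \<in> projection P A" for Q
    using that finA \<open>card A = m\<close> by (auto simp: projection_def intro: card_mono)
  then have "{Q \<in> projection F A. card Q \<le> k} \<subseteq> {Q \<in> projection P A. card Q \<le> min k m}"
    using \<open>F \<subseteq> P\<close> by (auto simp: projection_eq_image)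
  then have "real (card {Q \<in> projection F A. card Q \<le> k})
      \<le> real (card {Q \<in> projection P A. card Q \<le> min k m})"
    using finP by (intro of_nat_mono card_mono) (auto simp: projection_eq_image)
  also have "\<dots> \<le> C * real m powr d1 * real (min k m) powr d2"
  proof -
    have "m \<le> card X" using X assms(7,8) card_mono by auto
    then show ?thesis
      using ss[unfolded has_size_sensitive_constants_def, rule_format, of A m "min k m"] assms(7-10)
      by simp
  qed
  also have "\<dots> \<le> C * real m powr d1 * real k powr d2"
    using assms(4,5) by (intro mult_left_mono powr_mono2) auto
  finally show ?thesis .
qed

text \<open>Two sets of size \<open>l\<close> differ in at most \<open>2 * l\<close> points. This
  keeps \<open>l / \<delta>\<close> above 1/2, so that additive rounding errors can be absorbed
  later.\<close>

lemma separated_same_size: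
  assumes "separated \<delta> F" "finite F" "card F \<ge> 2" "\<And>S. S \<in> F \<Longrightarrow> card S = l \<and> finite S"
  shows "\<delta> < 2 * l"
proof -
  obtain S T where ST: "S \<in> F" "T \<in> F" "S \<noteq> T"
    using card_le_Suc0_iff_eq[OF assms(2)] assms(3) by fastforce
  then have "\<delta> < card (sym_diff S T)" using assms(1) by (auto simp: separated_def)
  also have "\<dots> \<le> card (S \<union> T)" using ST assms(4) by (intro card_mono) auto
  also have "\<dots> \<le> card S + card T" by (rule card_Un_le)
  finally show ?thesis using ST assms(4) by auto
qed

section \<open>Choice of parameters and the final constant\<close>

theorem theorem2:
  fixes d d1 d2 C :: real
  assumes "1 \<le> d" and "1 \<le> d1" and "d1 \<le> d" and "d2 = d - d1" and "C > 0"
  shows "\<exists>c>0. \<forall>(X :: 'a set) (P :: 'a set set) (n :: nat) (\<delta> :: nat) (l :: nat).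
           finite X \<and> card X = n \<and> P \<subseteq> Pow X \<and>
           has_primal_shatter_dim X P d C \<and>
           has_size_sensitive_constants X P d1 d2 C \<and>
           \<delta> \<in> {1..n} \<and> separated \<delta> P \<and>
           nondegenerate_layer P d2 \<delta> l \<longrightarrow>
           real (card (layer P l)) \<le>
             c * real_pow (real n / real \<delta>) d1 * real_pow (real l / real \<delta>) d2"
proof -
  obtain D where D: "D \<ge> 1" "\<And>b. b \<ge> D \<Longrightarrow> C * real b powr d < 2 ^ b"
    using shatter_function_below_power2[of C d] by auto
  \<comment> \<open>The factor \<open>2 * C + 1\<close> covers the \<open>2 * C\<close> of the
    packing bound, the \<open>C\<close> of the direct bound and the 1 of a single set. The base
    \<open>38 * D\<close> dominates all multiples of \<open>x\<close> and \<open>y\<close> that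
    occur: 1, 2, \<open>\<delta> \<le> 9 * D\<close>, \<open>9 * D\<close> and
    \<open>38 * D\<close>.\<close>
  define c where "c = (2 * C + 1) * (38 * real D) powr d"
  have d2: "d2 \<ge> 0" "d = d1 + d2" using assms(3,4) by simp_all
  have params: "0 \<le> d1" "0 \<le> d2" "0 < C" using assms(2,5) d2(1) by simp_all
  have D1: "real D \<ge> 1" using D by simp
  have "c > 0" using D1 params by (simp add: c_def)
  show ?thesis
  proof (intro exI[of _ c] conjI \<open>c > 0\<close> allI impI, elim conjE)
    fix X :: "'a set" and P :: "'a set set" and n \<delta> l :: nat
    assume X: "finite X" and n: "card X = n" and P: "P \<subseteq> Pow X"
      and dim: "has_primal_shatter_dim X P d C" and ss: "has_size_sensitive_constants X P d1 d2 C"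
      and \<delta>: "\<delta> \<in> {1..n}" and sep: "separated \<delta> P" and nondeg: "nondegenerate_layer P d2 \<delta> l"
    define F where "F = layer P l"
    have F: "F \<subseteq> P" "\<And>S. S \<in> F \<Longrightarrow> card S = l" by (auto simp: F_def layer_def)
    have FX: "F \<subseteq> Pow X" using F P by auto
    have finF: "finite F" using X FX by (meson finite_Pow_iff finite_subset)
    have sepF: "separated \<delta> F" using sep F by (auto simp: separated_def)
    define x where "x = real n / real \<delta>"
    define y where "y = real l / real \<delta>"
    have x: "x \<ge> 1" using \<delta> by (simp add: x_def)
    have rpx: "real_pow x d1 = x powr d1" using assms(2) by (simp add: real_pow_def)
    have c_ge: "c \<ge> K * a powr d1 * b powr d2"
      if "0 \<le> K" "K \<le> 2 * C + 1" "0 \<le> a" "a \<le> 38 * real D" "0 \<le> b" "b \<le> 38 * real D" for K a b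
    proof -
      have "K * a powr d1 * b powr d2 \<le> (2 * C + 1) * (38 * real D) powr d1 * (38 * real D) powr d2"
        using that params by (intro mult_mono powr_mono2) auto
      then show ?thesis by (simp add: c_def d2(2) powr_add mult.assoc)
    qed
    have scaled: "K * (a * x) powr d1 * (b * y) powr d2 \<le> c * x powr d1 * y powr d2"
      if "0 \<le> K" "K \<le> 2 * C + 1" "0 \<le> a" "a \<le> 38 * real D" "0 \<le> b" "b \<le> 38 * real D" for K a b
    proof -
      have "y \<ge> 0" by (simp add: y_def)
      then have "K * (a * x) powr d1 * (b * y) powr d2 = (K * a powr d1 * b powr d2) * (x powr d1 * y powr d2)"
        using that x by (simp add: powr_mult mult_ac)
      also have "\<dots> \<le> c * (x powr d1 * y powr d2)" by (intro mult_right_mono c_ge[OF that]) auto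
      finally show ?thesis by (simp add: mult.assoc)
    qed
    have "real (card F) \<le> c * real_pow x d1 * real_pow y d2"
    proof (cases "card F \<ge> 2")
      case False
      then consider "card F = 0" | "card F = 1" by linarith
      then show ?thesis
      proof cases
        case 1
        then show ?thesis using \<open>c > 0\<close> by (simp add: real_pow_def)
      next
        case 2
        have x1: "1 \<le> x powr d1" using x params by (intro ge_one_powr_ge_zero) auto
        show ?thesis
        proof (cases "d2 = 0")
          case True
          \<comment> \<open>For \<open>d2 = 0\<close> the convention of \<open>real_pow\<close>
            makes the second factor 1 even when \<open>l = 0\<close>.\<close>
          have "1 \<le> c" using c_ge[of 1 1 1] D1 params by simp
          then have "1 * 1 \<le> c * x powr d1" using x1 by (intro mult_mono) auto
          then show ?thesis using 2 True rpx by (simp add: real_pow_def)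
        next
          case False
          then have "\<delta> \<le> 2 * l" using nondeg 2 params by (simp add: nondegenerate_layer_def F_def)
          then have "real \<delta> \<le> 2 * real l" by linarith
          then have "1 \<le> 2 * y" using \<delta> by (simp add: y_def field_simps)
          then have "1 * 1 \<le> x powr d1 * (2 * y) powr d2"
            using params by (intro mult_mono x1 ge_one_powr_ge_zero) auto
          also have "\<dots> \<le> c * x powr d1 * y powr d2"
            using scaled[of 1 1 2] D1 params by simp
          finally show ?thesis using 2 False rpx by (simp add: real_pow_def)
        qed
      qed
    next
      case True
      have \<delta>l: "\<delta> < 2 * l"
      proof (rule separated_same_size[OF sepF finF True])
        show "card S = l \<and> finite S" if "S \<in> F" for S
          using that F(2) FX X by (meson PowD finite_subset subsetD)
      qed
      then have l: "l \<ge> 1" using \<delta> by auto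
      have y: "y > 0" "1 \<le> 2 * y" using \<delta>l \<delta> by (auto simp: y_def field_simps)
      have rpy: "real_pow y d2 = y powr d2" using y by (simp add: real_pow_def)
      have l\<delta>: "real l = real \<delta> * y" and n\<delta>: "real n = real \<delta> * x" using \<delta> by (auto simp: x_def y_def)
      note shallow = size_sensitive_projection_bound[OF X P ss \<open>C > 0\<close> d2(1) F(1)]
      show ?thesis
      proof (cases "\<delta> \<le> 9 * D")
        case True
        \<comment> \<open>Every member of \<open>F\<close> is its own trace on \<open>X\<close>, so
          the size-sensitive bound applies with \<open>m = n\<close> and \<open>k = l\<close>.
          Writing \<open>n = \<delta> * x\<close> and \<open>l = \<delta> * y\<close> leaves powers
          of the bounded \<open>\<delta>\<close>.\<close>
        have "F \<subseteq> {Q \<in> projection F X. card Q \<le> l}"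
        proof
          fix S assume "S \<in> F"
          moreover from this have "S \<inter> X = S" using FX by auto
          ultimately show "S \<in> {Q \<in> projection F X. card Q \<le> l}"
            using F(2) by (auto simp: projection_def)
        qed
        then have "real (card F) \<le> real (card {Q \<in> projection F X. card Q \<le> l})"
          using finF by (intro of_nat_mono card_mono) (auto simp: projection_eq_image)
        also have "\<dots> \<le> C * real n powr d1 * real l powr d2"
          using shallow[of X n l] \<delta> l n by auto
        also have "\<dots> \<le> c * x powr d1 * y powr d2"
          unfolding l\<delta> n\<delta> using scaled[of C "real \<delta>" "real \<delta>"] True params by simp
        finally show ?thesis unfolding rpx rpy .
      next
        case False
        \<comment> \<open>Here \<open>k\<close> is four times the mean trace size
          \<open>l * m / n\<close>, rounded up. Both \<open>m\<close> and \<open>k\<close> are at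
          least 1, as the size-sensitive bound requires.\<close>
        define m where "m = nat \<lceil>8 * real D * x\<rceil>"
        define k where "k = nat \<lceil>4 * real l * real m / real n\<rceil>"
        have pos: "0 < 8 * real D * x" using D1 x by simp
        have m_ge: "8 * real D * x \<le> real m" unfolding m_def by linarith
        have m1: "m \<ge> 1" using m_ge pos by (cases m) auto
        have Dx: "1 \<le> real D * x" using mult_mono[of 1 "real D" 1 x] D1 x by simp
        have m_le: "real m \<le> 9 * real D * x"
          using pos Dx unfolding m_def by linarith
        \<comment> \<open>The case assumption \<open>\<delta> > 9 * D\<close> is what makes
          \<open>m\<close> fit into \<open>X\<close>.\<close>
        have "9 * real D * x \<le> real \<delta> * x" using False x by (intro mult_right_mono) linarith+
        then have m_n: "m \<le> n" using m_le n\<delta> by simp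
        have npos: "real n > 0" using \<delta> by simp
        have k_ge: "4 * real l * real m / real n \<le> real k" unfolding k_def by linarith
        have "0 < 4 * real l * real m / real n" using l m1 npos by simp
        then have k1: "k \<ge> 1" using k_ge by (cases k) auto
        have "4 * real l * real m / real n \<le> 4 * real l * (9 * real D * x) / real n"
          using m_le by (intro divide_right_mono mult_left_mono) auto
        also have "\<dots> = 36 * real D * y" using npos \<delta> by (simp add: x_def y_def)
        finally have "real k \<le> 36 * real D * y + 1"
          using \<open>0 < 4 * real l * real m / real n\<close> unfolding k_def by linarith
        \<comment> \<open>The rounding error 1 is absorbed through \<open>2 * y \<ge> 1\<close>, so
          that 36 + 2 gives the constant 38.\<close>
        moreover have "1 \<le> 2 * real D * y" using mult_mono[of 1 "real D" 1 "2 * y"] D1 y by simp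
        ultimately have k_le: "real k \<le> 38 * real D * y" by linarith
        have "real (card F) \<le> 2 * (C * real m powr d1 * real k powr d2)"
        proof (rule shallow_packing_bound[OF X _ FX sepF _ F(2)])
          show "X \<noteq> {}" "\<delta> > 0" using n \<delta> by auto
          show "card B < D" if "B \<subseteq> X" "projection F B = Pow B" for B
          proof (rule shattered_card_less[OF X P dim D that(1)])
            show "projection P B = Pow B"
              using that(2) image_mono[OF F(1), of "\<lambda>S. S \<inter> B"] by (auto simp: projection_eq_image)
          qed
          show "m \<le> card X" using m_n n by simp
          have "8 * real D * real n = real \<delta> * (8 * real D * x)" by (simp add: n\<delta>)
          also have "\<dots> \<le> real \<delta> * real (Suc m)" using m_ge by (intro mult_left_mono) auto
          finally have "real (8 * D * n) \<le> real (\<delta> * Suc m)"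
            by (simp only: of_nat_mult of_nat_numeral)
          then show "8 * D * card X \<le> \<delta> * Suc m" unfolding n of_nat_le_iff .
          have "4 * real l * real m \<le> real n * real k"
            using k_ge npos by (simp add: field_simps)
          also have "\<dots> \<le> real n * real (Suc k)" by (intro mult_left_mono) auto
          finally have "real (4 * l * m) \<le> real (n * Suc k)"
            by (simp only: of_nat_mult of_nat_numeral)
          then show "4 * l * m \<le> card X * Suc k" unfolding n of_nat_le_iff .
          show "real (card {Q \<in> projection F A. card Q \<le> k}) \<le> C * real m powr d1 * real k powr d2"
            if "A \<subseteq> X" "card A = m" for A
            using shallow that m1 k1 by blast
        qed
        also have "\<dots> \<le> 2 * (C * (9 * real D * x) powr d1 * (38 * real D * y) powr d2)"
          using params m_le k_le by (intro mult_left_mono mult_mono powr_mono2) auto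
        also have "\<dots> \<le> c * x powr d1 * y powr d2"
          using scaled[of "2 * C" "9 * real D" "38 * real D"] D1 params by simp
        finally show ?thesis unfolding rpx rpy .
      qed
    qed
    then show "real (card (layer P l)) \<le>
        c * real_pow (real n / real \<delta>) d1 * real_pow (real l / real \<delta>) d2"
      by (simp add: F_def x_def y_def)
  qed
qed

end
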